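(* Let $P\subset\mathbb{R}^n$ be an $n$-dimensional polytope that is the convex hull of a set $S$ of $n+2$ lattice points, and let $p_{\min}$ be the minimal $p$ such that $S$ admits a $(p,q)$-partition. Then $\operatorname{vol}(P)\ge\dfrac{p_{\min}+1}{n!}$.
   Context: A $(p,q)$-partition of $S$ (with $p+q=n$) is a partition $S=A\sqcup B$ with $|A|=p+1$, $|B|=q+1$ such that $\Delta=\operatorname{conv}A$ and $\Delta'=\operatorname{conv}B$ are simplices of dimensions $p$ and $q$ spanning complementary affine subspaces and $\Delta\cap\Delta'$ consists of exactly one point (the Radon point); then $P=\operatorname{conv}(\Delta\cup\Delta')$. Such a partition always exists (Radon's theorem). Volume is Lebesgue measure on $\mathbb{R}^n$. *)

theory Defs
  imports "HOL-Analysis.Analysis"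
begin

text \<open>Lattice points of the space real^'n (dimension n = CARD('n)).\<close>
definition lattice_point :: "real^'n \<Rightarrow> bool" where
  "lattice_point x \<longleftrightarrow> (\<forall>i. x $ i \<in> \<int>)"

text \<open>Direction (linear) subspace of the affine hull of a nonempty finite point set.\<close>
definition direction_of :: "(real^'n) set \<Rightarrow> (real^'n) set" where
  "direction_of A = span {y - x | x y. x \<in> A \<and> y \<in> A}"

text \<open>(p,q)-partition of S, with p + q = n.\<close>
definition pq_partition ::
  "(real^'n) set \<Rightarrow> (real^'n) set \<Rightarrow> (real^'n) set \<Rightarrow> nat \<Rightarrow> nat \<Rightarrow> bool" where
  "pq_partition S A B p q \<longleftrightarrow>
     p + q = CARD('n) \<and>
     S = A \<union> B \<and> A \<inter> B = {} \<and>
     finite A \<and> finite B \<and> card A = p + 1 \<and> card B = q + 1 \<and>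
     \<not> affine_dependent A \<and> \<not> affine_dependent B \<and>
     direction_of A \<inter> direction_of B = {0} \<and>
     {u + v | u v. u \<in> direction_of A \<and> v \<in> direction_of B} = UNIV \<and>
     (\<exists>x. convex hull A \<inter> convex hull B = {x})"

definition p_min :: "(real^'n) set \<Rightarrow> nat" where
  "p_min S = (LEAST p. \<exists>A B q. pq_partition S A B p q)"

end

theory Submission
  imports Defs
begin

text \<open>Since \<open>S\<close> has \<open>n + 2\<close> points and spans \<open>\<real>\<^sup>n\<close> affinely, its affine dependences form a
  line, spanned by some \<open>c\<close>. Splitting \<open>S\<close> by the sign of \<open>c\<close> gives a \<open>(p,q)\<close>-partition
  \<open>A \<union> B\<close> with \<open>A = {c > 0}\<close>, so \<open>p_min \<le> |A| - 1\<close>. For \<open>a \<in> A\<close> the simplex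
  \<open>conv (S - {a})\<close> is full-dimensional with lattice vertices, so its volume \<open>|det|/n!\<close> is at
  least \<open>1/n!\<close>. These \<open>|A|\<close> simplices lie in \<open>conv S\<close> and overlap only in lower-dimensional
  sets, because a point in two of them would give an affine dependence of the wrong sign pattern.\<close>

section \<open>The affine dependence of \<open>n + 2\<close> spanning points\<close>

lemma sum_if_mem_subset:
  assumes "finite S" "X \<subseteq> S"
  shows "(\<Sum>v\<in>S. if v \<in> X then g v else 0) = sum g X"
  using sum.inter_restrict [OF assms(1), of g X] assms(2) by (simp add: Int_absorb1)

lemma mem_convex_hull_subset_finite:
  fixes S :: "'a::real_vector set"
  assumes "finite S" "X \<subseteq> S"
  shows "x \<in> convex hull X \<longleftrightarrow>
    (\<exists>u. (\<forall>v\<in>S. 0 \<le> u v) \<and> (\<forall>v\<in>S - X. u v = 0) \<and> sum u S = 1 \<and> (\<Sum>v\<in>S. u v *\<^sub>R v) = x)"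
proof -
  have "finite X"
    using assms finite_subset by blast
  show ?thesis
  proof
    assume "x \<in> convex hull X"
    then obtain u where u: "\<forall>v\<in>X. 0 \<le> u v" "sum u X = 1" "(\<Sum>v\<in>X. u v *\<^sub>R v) = x"
      by (auto simp: convex_hull_finite [OF \<open>finite X\<close>])
    define w where "w v = (if v \<in> X then u v else 0)" for v
    have "sum w S = sum u X" "(\<Sum>v\<in>S. w v *\<^sub>R v) = (\<Sum>v\<in>X. u v *\<^sub>R v)"
      by (simp_all add: w_def if_smult sum_if_mem_subset [OF assms] cong: if_cong)
    then show "\<exists>u. (\<forall>v\<in>S. 0 \<le> u v) \<and> (\<forall>v\<in>S - X. u v = 0) \<and> sum u S = 1 \<and> (\<Sum>v\<in>S. u v *\<^sub>R v) = x"
      using u by (intro exI [of _ w]) (auto simp: w_def)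
  next
    assume "\<exists>u. (\<forall>v\<in>S. 0 \<le> u v) \<and> (\<forall>v\<in>S - X. u v = 0) \<and> sum u S = 1 \<and> (\<Sum>v\<in>S. u v *\<^sub>R v) = x"
    then obtain u where u: "\<forall>v\<in>S. 0 \<le> u v" "\<forall>v\<in>S - X. u v = 0" "sum u S = 1" "(\<Sum>v\<in>S. u v *\<^sub>R v) = x"
      by blast
    moreover have "sum u X = sum u S" "(\<Sum>v\<in>X. u v *\<^sub>R v) = (\<Sum>v\<in>S. u v *\<^sub>R v)"
      using u(2) assms by (intro sum.mono_neutral_left; auto)+
    ultimately have "sum u X = 1" "(\<Sum>v\<in>X. u v *\<^sub>R v) = x"
      by simp_all
    then show "x \<in> convex hull X"
      using u assms(2) by (auto simp: convex_hull_finite [OF \<open>finite X\<close>])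
  qed
qed

lemma subspace_zero_sum_combinations:
  fixes A :: "'a::real_vector set"
  shows "subspace {\<Sum>v\<in>A. u v *\<^sub>R v | u. sum u A = 0}"
    (is "subspace ?Z")
proof (unfold subspace_def, intro conjI ballI allI)
  show "0 \<in> ?Z"
    by (intro CollectI exI [of _ "\<lambda>_. 0"]) simp
next
  fix x y assume "x \<in> ?Z" "y \<in> ?Z"
  then obtain u w where "x = (\<Sum>v\<in>A. u v *\<^sub>R v)" "sum u A = 0" "y = (\<Sum>v\<in>A. w v *\<^sub>R v)" "sum w A = 0"
    by blast
  then show "x + y \<in> ?Z"
    by (intro CollectI exI [of _ "\<lambda>v. u v + w v"]) (simp add: sum.distrib scaleR_add_left)
next
  fix r :: real and x assume "x \<in> ?Z"
  then obtain u where "x = (\<Sum>v\<in>A. u v *\<^sub>R v)" "sum u A = 0"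
    by blast
  then show "r *\<^sub>R x \<in> ?Z"
    by (intro CollectI exI [of _ "\<lambda>v. r * u v"]) (simp add: scaleR_sum_right sum_distrib_left [symmetric])
qed

lemma span_differences_eq_zero_sum_combinations:
  fixes A :: "'a::real_vector set"
  assumes "finite A" "A \<noteq> {}"
  shows "span {y - x | x y. x \<in> A \<and> y \<in> A} = {\<Sum>v\<in>A. u v *\<^sub>R v | u. sum u A = 0}"
    (is "span ?D = ?Z")
proof
  have "?D \<subseteq> ?Z"
  proof
    fix z assume "z \<in> ?D"
    then obtain x y where "z = y - x" "x \<in> A" "y \<in> A"
      by blast
    then show "z \<in> ?Z"
      using assms(1)
      by (intro CollectI exI [of _ "\<lambda>v. of_bool (v = y) - of_bool (v = x)"])
         (simp add: sum_subtractf scaleR_left_diff_distrib of_bool_def if_smult cong: if_cong)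
  qed
  then show "span ?D \<subseteq> ?Z"
    using span_minimal subspace_zero_sum_combinations by blast
next
  obtain a where "a \<in> A"
    using assms(2) by blast
  show "?Z \<subseteq> span ?D"
  proof
    fix z assume "z \<in> ?Z"
    then obtain u where "z = (\<Sum>v\<in>A. u v *\<^sub>R v)" "sum u A = 0"
      by blast
    then have "z = (\<Sum>v\<in>A. u v *\<^sub>R (v - a))"
      by (simp add: scaleR_right_diff_distrib sum_subtractf scaleR_sum_left [symmetric])
    also have "\<dots> \<in> span ?D"
      using \<open>a \<in> A\<close> by (intro span_sum span_scale span_base) blast
    finally show "z \<in> span ?D" .
  qed
qed

lemma mem_affine_hull_delete_if_dependence:
  fixes S :: "'a::real_vector set"
  assumes "finite S" "sum c S = 0" "(\<Sum>v\<in>S. c v *\<^sub>R v) = 0" "s \<in> S" "c s \<noteq> 0"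
  shows "s \<in> affine hull (S - {s})"
proof -
  have "sum c (S - {s}) = - c s" "(\<Sum>v\<in>S - {s}. c v *\<^sub>R v) = - (c s *\<^sub>R s)"
    using assms sum.remove [OF assms(1,4), of c] sum.remove [OF assms(1,4), of "\<lambda>v. c v *\<^sub>R v"]
    by (simp_all add: eq_neg_iff_add_eq_0 add.commute)
  moreover have "(\<Sum>v\<in>S - {s}. (- c v / c s) *\<^sub>R v) = (- 1 / c s) *\<^sub>R (\<Sum>v\<in>S - {s}. c v *\<^sub>R v)"
    by (simp add: scaleR_sum_right)
  ultimately have "sum (\<lambda>v. - c v / c s) (S - {s}) = 1" "(\<Sum>v\<in>S - {s}. (- c v / c s) *\<^sub>R v) = s"
    using assms(5) by (simp_all add: sum_divide_distrib [symmetric] sum_negf)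
  then show ?thesis
    unfolding affine_hull_finite [OF finite_Diff [OF assms(1)]] by blast
qed

text \<open>\<open>c\<close> spans the line of affine dependences of \<open>S\<close>; its sign splits \<open>S\<close> into the two
  halves \<open>positives\<close> and \<open>nonpositives\<close> of the Radon partition.\<close>

locale unique_affine_dependence =
  fixes S :: "'a::real_vector set" and c :: "'a \<Rightarrow> real"
  assumes finite: "finite S"
    and sum_eq_0: "sum c S = 0"
    and combination_eq_0: "(\<Sum>v\<in>S. c v *\<^sub>R v) = 0"
    and nontrivial: "\<exists>v\<in>S. c v \<noteq> 0"
    and unique: "\<And>d. sum d S = 0 \<Longrightarrow> (\<Sum>v\<in>S. d v *\<^sub>R v) = 0 \<Longrightarrow> \<exists>t. \<forall>v\<in>S. d v = t * c v"
begin

abbreviation positives where "positives \<equiv> {v \<in> S. 0 < c v}"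
abbreviation nonpositives where "nonpositives \<equiv> {v \<in> S. c v \<le> 0}"

lemma affine_independent_if_avoids:
  assumes "X \<subseteq> S" "w \<in> S - X" "c w \<noteq> 0"
  shows "\<not> affine_dependent X"
proof
  assume "affine_dependent X"
  moreover have "finite X"
    using assms(1) finite finite_subset by blast
  ultimately obtain d where d: "sum d X = 0" "\<exists>v\<in>X. d v \<noteq> 0" "(\<Sum>v\<in>X. d v *\<^sub>R v) = 0"
    by (auto simp: affine_dependent_explicit_finite)
  define e where "e v = (if v \<in> X then d v else 0)" for v
  have "sum e S = 0" "(\<Sum>v\<in>S. e v *\<^sub>R v) = 0"
    using d by (simp_all add: e_def if_smult sum_if_mem_subset [OF finite assms(1)] cong: if_cong)
  then obtain t where t: "\<forall>v\<in>S. e v = t * c v"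
    using unique by blast
  then have "t = 0"
    using assms(2,3) by (force simp: e_def)
  then show False
    using d(2) t assms(1) by (force simp: e_def)
qed

lemma exists_positive: "\<exists>v\<in>S. 0 < c v"
proof (rule ccontr)
  assume "\<not> (\<exists>v\<in>S. 0 < c v)"
  moreover have "sum (\<lambda>v. - c v) S = 0"
    using sum_eq_0 by (simp add: sum_negf)
  ultimately have "\<forall>v\<in>S. - c v = 0"
    using sum_nonneg_eq_0_iff [OF finite, of "\<lambda>v. - c v"] by (simp add: not_less)
  then show False
    using nontrivial by simp
qed

lemma exists_negative: "\<exists>v\<in>S. c v < 0"
proof (rule ccontr)
  assume "\<not> (\<exists>v\<in>S. c v < 0)"
  then have "\<forall>v\<in>S. c v = 0"
    using sum_nonneg_eq_0_iff [OF finite, of c] sum_eq_0 by (auto simp: not_less)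
  then show False
    using nontrivial by simp
qed

lemma sum_positives_gt_0: "0 < sum c positives"
  using exists_positive finite by (intro sum_pos) auto

lemma sum_split_sign: "sum g S = sum g positives + sum g nonpositives"
proof -
  have "positives \<union> nonpositives = S" "positives \<inter> nonpositives = {}"
    by auto
  then show ?thesis
    using finite sum.union_disjoint [of positives nonpositives g] by simp
qed

lemma proportional_if_equal_combinations:
  assumes "sum \<alpha> positives = sum \<beta> nonpositives"
    and "(\<Sum>v\<in>positives. \<alpha> v *\<^sub>R v) = (\<Sum>v\<in>nonpositives. \<beta> v *\<^sub>R v)"
  obtains t where "\<forall>v\<in>positives. \<alpha> v = t * c v" "\<forall>v\<in>nonpositives. \<beta> v = - (t * c v)"
proof -
  define d where "d v = (if 0 < c v then \<alpha> v else - \<beta> v)" for v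
  have "sum d positives = sum \<alpha> positives"
    "(\<Sum>v\<in>positives. d v *\<^sub>R v) = (\<Sum>v\<in>positives. \<alpha> v *\<^sub>R v)"
    by (auto simp: d_def intro: sum.cong)
  moreover have "sum d nonpositives = (\<Sum>v\<in>nonpositives. - \<beta> v)"
    "(\<Sum>v\<in>nonpositives. d v *\<^sub>R v) = (\<Sum>v\<in>nonpositives. - (\<beta> v *\<^sub>R v))"
    by (auto simp: d_def intro: sum.cong)
  ultimately have "sum d S = 0" "(\<Sum>v\<in>S. d v *\<^sub>R v) = 0"
    using assms by (simp_all add: sum_split_sign [of d] sum_split_sign [of "\<lambda>v. d v *\<^sub>R v"] sum_negf)
  then obtain t where "\<forall>v\<in>S. d v = t * c v"
    using unique by blast
  then show thesis
    by (intro that) (auto simp: d_def)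
qed

lemma zero_sum_combinations_Int:
  assumes "sum \<alpha> positives = 0" "sum \<beta> nonpositives = 0"
    and "(\<Sum>v\<in>positives. \<alpha> v *\<^sub>R v) = (\<Sum>v\<in>nonpositives. \<beta> v *\<^sub>R v)"
  shows "(\<Sum>v\<in>positives. \<alpha> v *\<^sub>R v) = 0"
proof -
  have "sum \<alpha> positives = sum \<beta> nonpositives"
    using assms(1,2) by simp
  then obtain t where t: "\<forall>v\<in>positives. \<alpha> v = t * c v" "\<forall>v\<in>nonpositives. \<beta> v = - (t * c v)"
    using assms(3) by (rule proportional_if_equal_combinations)
  then have "t * sum c positives = 0"
    using assms(1) by (simp add: sum_distrib_left)
  then have "t = 0"
    using sum_positives_gt_0 by simp
  then show ?thesis
    using t by simp
qed

lemma zero_sum_combination_split: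
  assumes "sum \<gamma> S = 0"
  obtains e where "sum e positives = 0" "sum e nonpositives = 0"
    and "(\<Sum>v\<in>S. \<gamma> v *\<^sub>R v) = (\<Sum>v\<in>positives. e v *\<^sub>R v) + (\<Sum>v\<in>nonpositives. e v *\<^sub>R v)"
proof
  define t where "t = sum \<gamma> positives / sum c positives"
  define e where "e v = \<gamma> v - t * c v" for v
  have "sum e positives = sum \<gamma> positives - t * sum c positives"
    by (simp add: e_def sum_subtractf sum_distrib_left)
  then show "sum e positives = 0"
    using sum_positives_gt_0 by (simp add: t_def)
  moreover have "sum e S = 0"
    using assms sum_eq_0 by (simp add: e_def sum_subtractf sum_distrib_left [symmetric])
  ultimately show "sum e nonpositives = 0"
    by (simp add: sum_split_sign [of e])
  have "(\<Sum>v\<in>S. e v *\<^sub>R v) = (\<Sum>v\<in>S. \<gamma> v *\<^sub>R v)"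
    using combination_eq_0
    by (simp add: e_def scaleR_left_diff_distrib sum_subtractf scaleR_sum_right [symmetric] flip: scaleR_scaleR)
  then show "(\<Sum>v\<in>S. \<gamma> v *\<^sub>R v) = (\<Sum>v\<in>positives. e v *\<^sub>R v) + (\<Sum>v\<in>nonpositives. e v *\<^sub>R v)"
    by (simp add: sum_split_sign [of "\<lambda>v. e v *\<^sub>R v"])
qed

lemma zero_sum_split_if_affine_hull_UNIV:
  assumes "affine hull S = UNIV"
  obtains e where "sum e positives = 0" "sum e nonpositives = 0"
    and "z = (\<Sum>v\<in>positives. e v *\<^sub>R v) + (\<Sum>v\<in>nonpositives. e v *\<^sub>R v)"
proof -
  obtain s where "s \<in> S"
    using exists_positive by blast
  then have "s + z \<in> {s + v | v. v \<in> span {x - s | x. x \<in> S - {s}}}"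
    using assms affine_hull_span [of s S] by blast
  then have "z \<in> span {x - s | x. x \<in> S - {s}}"
    by auto
  moreover have "span {x - s | x. x \<in> S - {s}} \<subseteq> span {y - x | x y. x \<in> S \<and> y \<in> S}"
    using \<open>s \<in> S\<close> by (intro span_mono) blast
  ultimately obtain \<gamma> where "sum \<gamma> S = 0" "z = (\<Sum>v\<in>S. \<gamma> v *\<^sub>R v)"
    using span_differences_eq_zero_sum_combinations [OF finite] \<open>s \<in> S\<close> by blast
  moreover obtain e where "sum e positives = 0" "sum e nonpositives = 0"
    and "(\<Sum>v\<in>S. \<gamma> v *\<^sub>R v) = (\<Sum>v\<in>positives. e v *\<^sub>R v) + (\<Sum>v\<in>nonpositives. e v *\<^sub>R v)"
    using \<open>sum \<gamma> S = 0\<close> by (rule zero_sum_combination_split)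
  ultimately show thesis
    using that by simp
qed

lemma affine_independent_positives: "\<not> affine_dependent positives"
proof -
  obtain w where "w \<in> S" "c w < 0"
    using exists_negative by blast
  then show ?thesis
    by (intro affine_independent_if_avoids [of _ w]) auto
qed

lemma affine_independent_nonpositives: "\<not> affine_dependent nonpositives"
proof -
  obtain w where "w \<in> S" "0 < c w"
    using exists_positive by blast
  then show ?thesis
    by (intro affine_independent_if_avoids [of _ w]) auto
qed

lemma convex_hull_positives_Int_nonpositives: "\<exists>x. convex hull positives \<inter> convex hull nonpositives = {x}"
proof
  define \<sigma> where "\<sigma> = sum c positives"
  define x where "x = (1 / \<sigma>) *\<^sub>R (\<Sum>v\<in>positives. c v *\<^sub>R v)"
  have "0 < \<sigma>"
    using sum_positives_gt_0 by (simp add: \<sigma>_def)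
  have finite_parts: "finite positives" "finite nonpositives"
    using finite by auto
  have "sum (\<lambda>v. c v / \<sigma>) positives = 1" "(\<Sum>v\<in>positives. (c v / \<sigma>) *\<^sub>R v) = x"
    using \<open>0 < \<sigma>\<close> by (simp_all add: \<sigma>_def x_def sum_divide_distrib [symmetric] scaleR_sum_right)
  then have "x \<in> convex hull positives"
    using \<open>0 < \<sigma>\<close> unfolding convex_hull_finite [OF finite_parts(1)]
    by (intro CollectI exI [of _ "\<lambda>v. c v / \<sigma>"]) auto
  have "sum c nonpositives = - \<sigma>" "(\<Sum>v\<in>nonpositives. c v *\<^sub>R v) = - (\<Sum>v\<in>positives. c v *\<^sub>R v)"
    using sum_eq_0 combination_eq_0 sum_split_sign [of c] sum_split_sign [of "\<lambda>v. c v *\<^sub>R v"]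
    by (auto simp: \<sigma>_def eq_neg_iff_add_eq_0 add.commute)
  moreover have "(\<Sum>v\<in>nonpositives. (- c v / \<sigma>) *\<^sub>R v) = (- 1 / \<sigma>) *\<^sub>R (\<Sum>v\<in>nonpositives. c v *\<^sub>R v)"
    by (simp add: scaleR_sum_right)
  ultimately have "sum (\<lambda>v. - c v / \<sigma>) nonpositives = 1" "(\<Sum>v\<in>nonpositives. (- c v / \<sigma>) *\<^sub>R v) = x"
    using \<open>0 < \<sigma>\<close> by (simp_all add: x_def sum_divide_distrib [symmetric] sum_negf)
  then have "x \<in> convex hull nonpositives"
    using \<open>0 < \<sigma>\<close> unfolding convex_hull_finite [OF finite_parts(2)]
    by (intro CollectI exI [of _ "\<lambda>v. - c v / \<sigma>"]) (auto simp: divide_nonpos_pos)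
  have "y = x" if y: "y \<in> convex hull positives" "y \<in> convex hull nonpositives" for y
  proof -
    obtain \<alpha> \<beta> where \<alpha>: "sum \<alpha> positives = 1" "(\<Sum>v\<in>positives. \<alpha> v *\<^sub>R v) = y"
      and \<beta>: "sum \<beta> nonpositives = 1" "(\<Sum>v\<in>nonpositives. \<beta> v *\<^sub>R v) = y"
      using y by (auto simp: convex_hull_finite [OF finite_parts(1)] convex_hull_finite [OF finite_parts(2)])
    then have "sum \<alpha> positives = sum \<beta> nonpositives"
      "(\<Sum>v\<in>positives. \<alpha> v *\<^sub>R v) = (\<Sum>v\<in>nonpositives. \<beta> v *\<^sub>R v)"
      by simp_all
    then obtain t where t: "\<forall>v\<in>positives. \<alpha> v = t * c v" "\<forall>v\<in>nonpositives. \<beta> v = - (t * c v)"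
      by (rule proportional_if_equal_combinations)
    then have "t * \<sigma> = 1"
      using \<alpha>(1) by (simp add: \<sigma>_def sum_distrib_left)
    moreover have "y = t *\<^sub>R (\<Sum>v\<in>positives. c v *\<^sub>R v)"
      using t \<alpha>(2) by (simp add: scaleR_sum_right)
    ultimately show "y = x"
      using \<open>0 < \<sigma>\<close> by (simp add: x_def field_simps)
  qed
  then show "convex hull positives \<inter> convex hull nonpositives = {x}"
    using \<open>x \<in> convex hull positives\<close> \<open>x \<in> convex hull nonpositives\<close> by blast
qed

lemma convex_hull_delete_Int_subset:
  assumes "a \<in> positives" "a' \<in> positives"
  shows "convex hull (S - {a}) \<inter> convex hull (S - {a'}) \<subseteq> convex hull (S - {a, a'})"
proof
  fix y assume y: "y \<in> convex hull (S - {a}) \<inter> convex hull (S - {a'})"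
  have weights: "\<exists>u. (\<forall>v\<in>S. 0 \<le> u v) \<and> (\<forall>v\<in>S - X. u v = 0) \<and> sum u S = 1 \<and> (\<Sum>v\<in>S. u v *\<^sub>R v) = y"
    if "X \<subseteq> S" "y \<in> convex hull X" for X
    using mem_convex_hull_subset_finite [OF finite that(1)] that(2) by blast
  obtain \<alpha> where \<alpha>: "\<forall>v\<in>S. 0 \<le> \<alpha> v" "\<alpha> a = 0" "sum \<alpha> S = 1" "(\<Sum>v\<in>S. \<alpha> v *\<^sub>R v) = y"
    using weights [of "S - {a}"] y assms(1) by auto
  obtain \<beta> where \<beta>: "\<forall>v\<in>S. 0 \<le> \<beta> v" "\<beta> a' = 0" "sum \<beta> S = 1" "(\<Sum>v\<in>S. \<beta> v *\<^sub>R v) = y"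
    using weights [of "S - {a'}"] y assms(2) by auto
  have "sum (\<lambda>v. \<alpha> v - \<beta> v) S = 0" "(\<Sum>v\<in>S. (\<alpha> v - \<beta> v) *\<^sub>R v) = 0"
    using \<alpha> \<beta> by (simp_all add: sum_subtractf scaleR_left_diff_distrib)
  then obtain t where t: "\<forall>v\<in>S. \<alpha> v - \<beta> v = t * c v"
    using unique by blast
  \<comment> \<open>The weights vanish at \<open>a\<close> and \<open>a'\<close> respectively, so the signs of \<open>t * c\<close> there disagree.\<close>
  have "t * c a \<le> 0" "0 \<le> t * c a'"
    using t \<alpha> \<beta> assms by force+
  then have "t = 0"
    using assms by (auto simp: mult_le_0_iff zero_le_mult_iff)
  then have "\<alpha> a' = 0"
    using t \<beta>(2) assms(2) by force
  then show "y \<in> convex hull (S - {a, a'})"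
    using \<alpha> mem_convex_hull_subset_finite [OF finite, of "S - {a, a'}" y] by auto
qed

end

lemma unique_affine_dependence_exists:
  fixes S :: "'a::euclidean_space set"
  assumes "finite S" "aff_dim S = int (card S) - 2"
  obtains c where "unique_affine_dependence S c"
proof -
  have "affine_dependent S"
    using assms affine_independent_iff_card [of S] by simp
  then obtain c where c: "sum c S = 0" "\<exists>v\<in>S. c v \<noteq> 0" "(\<Sum>v\<in>S. c v *\<^sub>R v) = 0"
    by (auto simp: affine_dependent_explicit_finite [OF assms(1)])
  then obtain s where s: "s \<in> S" "c s \<noteq> 0"
    by blast
  have "affine hull (S - {s}) = affine hull S"
    using mem_affine_hull_delete_if_dependence [OF assms(1) c(1,3) s] hull_redundant [of s affine "S - {s}"] s(1)
    by (simp add: insert_absorb)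
  then have "aff_dim (S - {s}) = int (card (S - {s})) - 1"
    using assms s(1) aff_dim_affine_hull [of S] aff_dim_affine_hull [of "S - {s}"] card_gt_0_iff [of S]
    by (auto simp: of_nat_diff)
  then have independent: "\<not> affine_dependent (S - {s})"
    using assms(1) by (simp add: affine_independent_iff_card)
  show thesis
  proof (intro that unique_affine_dependence.intro)
    show "\<exists>t. \<forall>v\<in>S. d v = t * c v" if d: "sum d S = 0" "(\<Sum>v\<in>S. d v *\<^sub>R v) = 0" for d
    proof
      define t where "t = d s / c s"
      define e where "e v = d v - t * c v" for v
      have "e s = 0"
        using s(2) by (simp add: e_def t_def)
      moreover have "sum e S = 0" "(\<Sum>v\<in>S. e v *\<^sub>R v) = 0"
        using d c by (simp_all add: e_def sum_subtractf scaleR_left_diff_distrib sum_distrib_left [symmetric]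
            scaleR_sum_right [symmetric] flip: scaleR_scaleR)
      ultimately have "sum e (S - {s}) = 0" "(\<Sum>v\<in>S - {s}. e v *\<^sub>R v) = 0"
        using sum.remove [OF assms(1) s(1), of e] sum.remove [OF assms(1) s(1), of "\<lambda>v. e v *\<^sub>R v"] by simp_all
      then have "\<forall>v\<in>S - {s}. e v = 0"
        using independent affine_dependent_explicit_finite [of "S - {s}"] assms(1) by auto
      with \<open>e s = 0\<close> show "\<forall>v\<in>S. d v = t * c v"
        by (auto simp: e_def)
    qed
  qed (use assms(1) c in auto)
qed

section \<open>Volumes of lattice simplices\<close>

lemma measure_swap_image_cbox:
  fixes a b :: "real^'n" and m n :: 'n
  defines "h \<equiv> \<lambda>x::real^'n. \<chi> i. x $ Transposition.transpose m n i"
  shows "measure lebesgue (h ` cbox a b) = measure lebesgue (cbox a b)"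
proof (cases "cbox a b = {}")
  case False
  have image: "h ` cbox a b = cbox (h a) (h b)"
    by (auto simp: h_def image_iff lambda_swap_Galois mem_box_cart) (metis transpose_involutory)+
  then have "cbox (h a) (h b) \<noteq> {}"
    using False by auto
  then have "measure lebesgue (h ` cbox a b) = (\<Prod>i\<in>UNIV. (b - a) $ Transposition.transpose m n i)"
    by (simp add: image content_cbox_cart) (simp add: h_def)
  also have "\<dots> = (\<Prod>i\<in>UNIV. (b - a) $ i)"
    using prod.permute [OF permutes_swap_id, where S=UNIV and g="\<lambda>i. (b - a) $ i"] by (simp add: o_def)
  finally show ?thesis
    using False by (simp add: content_cbox_cart)
qed simp

lemma measure_shear_image_cbox:
  fixes a b :: "real^'n" and m n :: 'n
  assumes "m \<noteq> n"
  defines "h \<equiv> \<lambda>x::real^'n. \<chi> i. if i = m then x $ m + x $ n else x $ i"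
  shows "measure lebesgue (h ` cbox a b) = measure lebesgue (cbox a b)"
proof (cases "cbox a b = {}")
  case False
  define u :: "real^'n" where "u = axis n (a $ n)"
  have "linear h"
    by (rule linearI) (auto simp: h_def algebra_simps vec_eq_iff)
  have translate: "cbox (a - u) (b - u) = (+) (- u) ` cbox a b"
    by (metis cbox_translation add.commute diff_conv_add_uminus)
  then have "h ` cbox a b = (+) (h u) ` h ` cbox (a - u) (b - u)"
    using \<open>linear h\<close> by (simp add: image_image linear_diff)
  then have "measure lebesgue (h ` cbox a b) = measure lebesgue (h ` cbox (a - u) (b - u))"
    by (simp add: measure_translation)
  also have "\<dots> = measure lebesgue (cbox (a - u) (b - u))"
    unfolding h_def using False assms
    by (intro measure_shear_interval) (auto simp: translate, simp add: u_def)
  also have "\<dots> = measure lebesgue (cbox a b)"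
    by (simp add: translate measure_translation_subtract)
  finally show ?thesis .
qed simp

lemma measure_linear_image_eq_if_cbox:
  fixes f :: "'a::euclidean_space \<Rightarrow> 'a"
  assumes "linear f" "S \<in> lmeasurable"
    and "\<And>a b. measure lebesgue (f ` cbox a b) = measure lebesgue (cbox a b)"
  shows "measure lebesgue (f ` S) = measure lebesgue S"
  using measure_linear_sufficient [OF assms(1,2), of 1] assms(3) by simp

lemma swap_matrix_vector_mult:
  "(*v) (\<chi> i j. mat 1 $ i $ Transposition.transpose m n j :: real^'n^'n)
     = (\<lambda>x. \<chi> i. x $ Transposition.transpose m n i)"
proof -
  have "(\<Sum>j\<in>UNIV. mat 1 $ i $ Transposition.transpose m n j * x $ j)
      = (\<Sum>j\<in>UNIV. if j = Transposition.transpose m n i then x $ j else 0)" for i and x :: "real^'n"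
    by (rule sum.cong) (auto simp: mat_def)
  then show ?thesis
    by (simp add: matrix_vector_mult_def fun_eq_iff)
qed

lemma shear_matrix_vector_mult:
  assumes "m \<noteq> n"
  shows "(*v) (\<chi> i j. of_bool (i = m \<and> j = n \<or> i = j) :: real^'n^'n)
     = (\<lambda>x. \<chi> i. if i = m then x $ m + x $ n else x $ i)"
proof -
  have "(\<Sum>j\<in>UNIV. of_bool (i = m \<and> j = n \<or> i = j) * x $ j)
      = (\<Sum>j\<in>UNIV. (if j = i then x $ j else 0) + (if i = m \<and> j = n then x $ j else 0))"
    for i and x :: "real^'n"
    using assms by (intro sum.cong) auto
  then show ?thesis
    by (simp add: matrix_vector_mult_def fun_eq_iff sum.distrib vec_eq_iff)
qed

lemma det_shear_matrix:
  assumes "m \<noteq> n"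
  shows "det (\<chi> i j. of_bool (i = m \<and> j = n \<or> i = j) :: real^'n^'n) = 1"
proof -
  have "(\<chi> i j. of_bool (i = m \<and> j = n \<or> i = j) :: real^'n^'n)
      = (\<chi> k. if k = m then row m (mat 1) + 1 *s row n (mat 1) else row k (mat 1))"
    using assms by (auto simp: row_def mat_def vec_eq_iff)
  then show ?thesis
    using det_row_operation [OF assms, of "mat 1 :: real^'n^'n" 1] by simp
qed

text \<open>The library version \<open>measure_linear_image\<close> is stated only for index types of class
  \<open>wellorder\<close>; the elementary-matrix induction below needs no order on the index type.\<close>

lemma measure_matrix_image:
  fixes A :: "real^'n^'n"
  assumes "compact S"
  shows "measure lebesgue ((*v) A ` S) = \<bar>det A\<bar> * measure lebesgue S"
proof -
  have "\<forall>S. compact S \<longrightarrow> measure lebesgue ((*v) A ` S) = \<bar>det A\<bar> * measure lebesgue S"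
  proof (induction A rule: induct_matrix_elementary_alt)
    case (1 A B)
    show ?case
    proof (intro allI impI)
      fix S :: "(real^'n) set"
      assume "compact S"
      then have "compact ((*v) B ` S)"
        by (intro compact_continuous_image linear_continuous_on matrix_vector_mul_bounded_linear)
      moreover have "(*v) (A ** B) ` S = (*v) A ` (*v) B ` S"
        by (simp add: image_image matrix_vector_mul_assoc)
      ultimately show "measure lebesgue ((*v) (A ** B) ` S) = \<bar>det (A ** B)\<bar> * measure lebesgue S"
        using 1 \<open>compact S\<close> by (simp add: det_mul abs_mult)
    qed
  next
    case (2 A i)
    then have "\<not> inj ((*v) A)"
      using det_nz_iff_inj [OF matrix_vector_mul_linear, of A] by (simp add: det_zero_row)
    then show ?case
      using 2 by (simp add: det_zero_row negligible_imp_measure0 negligible_linear_singular_image)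
  next
    case (3 A)
    have "(\<Sum>j\<in>UNIV. A $ i $ j * x $ j) = (\<Sum>j\<in>UNIV. if j = i then A $ i $ i * x $ i else 0)"
      for i x by (rule sum.cong) (auto simp: 3)
    then have "(*v) A = (\<lambda>x. \<chi> i. A $ i $ i * x $ i)"
      by (simp add: matrix_vector_mult_def fun_eq_iff)
    then show ?case
      using 3 by (simp add: det_diagonal measure_stretch lmeasurable_compact)
  next
    case (4 m n)
    have "linear (\<lambda>x::real^'n. \<chi> i. x $ Transposition.transpose m n i)"
      unfolding swap_matrix_vector_mult [symmetric] by (rule matrix_vector_mul_linear)
    then show ?case
      using 4 by (simp add: swap_matrix_vector_mult det_permute_columns permutes_swap_id sign_swap_id
          measure_linear_image_eq_if_cbox measure_swap_image_cbox lmeasurable_compact)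
  next
    case (5 m n)
    have "linear (\<lambda>x::real^'n. \<chi> i. if i = m then x $ m + x $ n else x $ i)"
      unfolding shear_matrix_vector_mult [OF 5, symmetric] by (rule matrix_vector_mul_linear)
    then show ?case
      unfolding shear_matrix_vector_mult [OF 5] det_shear_matrix [OF 5]
      by (simp add: measure_linear_image_eq_if_cbox measure_shear_image_cbox [OF 5] lmeasurable_compact)
  qed
  with assms show ?thesis
    by blast
qed

lemma measure_convex_hull_simplex_cart:
  fixes x0 :: "real^'n" and f :: "'n \<Rightarrow> real^'n"
  shows "measure lebesgue (convex hull (insert x0 (range f)))
           = \<bar>det (\<chi> i j. f j $ i - x0 $ i)\<bar> / fact CARD('n)"
proof -
  define M :: "real^'n^'n" where "M = (\<chi> i j. f j $ i - x0 $ i)"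
  define std :: "(real^'n) set" where "std = convex hull (insert 0 Basis)"
  have "compact std"
    unfolding std_def by (intro finite_imp_compact_convex_hull) auto
  have "M *v axis j 1 = f j - x0" for j
    by (simp add: M_def matrix_vector_mult_basis column_def vec_eq_iff)
  then have "(+) x0 ` (*v) M ` insert 0 Basis = insert x0 (range f)"
    by (force simp: Basis_vec_def image_iff)
  then have "(+) x0 ` (*v) M ` std = convex hull (insert x0 (range f))"
    unfolding std_def
    by (metis convex_hull_linear_image convex_hull_translation matrix_vector_mul_linear)
  then have "measure lebesgue (convex hull (insert x0 (range f))) = \<bar>det M\<bar> * measure lebesgue std"
    using measure_matrix_image [OF \<open>compact std\<close>] by (metis measure_translation)
  also have "measure lebesgue std = 1 / fact CARD('n)"
    using \<open>compact std\<close> content_std_simplex [where 'a="real^'n"]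
    by (simp add: std_def measure_completion compact_imp_closed)
  finally show ?thesis
    by (simp add: M_def)
qed

lemma negligible_convex_iff_aff_dim:
  fixes S :: "'a::euclidean_space set"
  assumes "convex S"
  shows "negligible S \<longleftrightarrow> aff_dim S < DIM('a)"
proof -
  have "aff_dim S = DIM('a) \<Longrightarrow> S \<noteq> {}"
    using DIM_positive [where 'a='a] by auto
  then show ?thesis
    using assms aff_dim_le_DIM [of S]
    by (auto simp: negligible_convex_interior interior_rel_interior_gen rel_interior_eq_empty)
qed

lemma lattice_simplex_measure_ge:
  fixes V :: "(real^'n) set"
  assumes "finite V" "card V = CARD('n) + 1" "\<not> affine_dependent V"
    and "\<forall>v\<in>V. lattice_point v"
  shows "1 / fact CARD('n) \<le> measure lebesgue (convex hull V)"
proof -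
  obtain x0 where "x0 \<in> V"
    using assms(2) by fastforce
  then have "card (UNIV :: 'n set) = card (V - {x0})"
    using assms(1,2) by simp
  then obtain f :: "'n \<Rightarrow> real^'n" where "bij_betw f UNIV (V - {x0})"
    using finite_same_card_bij [of "UNIV :: 'n set" "V - {x0}"] assms(1) by auto
  then have V: "V = insert x0 (range f)"
    using \<open>x0 \<in> V\<close> by (auto simp: bij_betw_def)
  define M :: "real^'n^'n" where "M = (\<chi> i j. f j $ i - x0 $ i)"
  have volume: "measure lebesgue (convex hull V) = \<bar>det M\<bar> / fact CARD('n)"
    unfolding V M_def by (rule measure_convex_hull_simplex_cart)
  have "M $ i $ j \<in> \<int>" for i j
    using assms(4) \<open>x0 \<in> V\<close> by (simp add: V M_def lattice_point_def)
  then have "det M \<in> \<int>"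
    unfolding det_def by (intro Ints_sum Ints_mult Ints_prod Ints_of_int)
  moreover have "aff_dim (convex hull V) = CARD('n)"
    using assms(2) aff_dim_affine_independent [OF assms(3)] by (simp add: aff_dim_convex_hull)
  then have "\<not> negligible (convex hull V)"
    by (simp add: negligible_convex_iff_aff_dim)
  then have "det M \<noteq> 0"
    using volume negligible_iff_measure [of "convex hull V"] assms(1)
    by (auto simp: finite_imp_compact_convex_hull lmeasurable_compact)
  ultimately have "1 \<le> \<bar>det M\<bar>"
    by (rule Ints_nonzero_abs_ge1)
  then show ?thesis
    by (simp add: volume divide_right_mono)
qed

section \<open>The volume bound\<close>

lemma sum_measure_convex_hull_delete_le:
  fixes S :: "'a::euclidean_space set"
  assumes "unique_affine_dependence S c" "card S = DIM('a) + 2"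
  shows "(\<Sum>a\<in>{v\<in>S. 0 < c v}. measure lebesgue (convex hull (S - {a}))) \<le> measure lebesgue (convex hull S)"
proof -
  interpret unique_affine_dependence S c
    by fact
  have measurable: "convex hull X \<in> lmeasurable" if "X \<subseteq> S" for X
    using finite that by (meson finite_subset finite_imp_compact_convex_hull lmeasurable_compact)
  have "negligible (convex hull (S - {a}) \<inter> convex hull (S - {a'}))"
    if "a \<in> positives" "a' \<in> positives" "a \<noteq> a'" for a a'
  proof -
    have "card (S - {a, a'}) = DIM('a)"
      using that finite assms(2) by (simp add: card_Diff_subset)
    then have "aff_dim (convex hull (S - {a, a'})) < DIM('a)"
      using aff_dim_le_card [of "S - {a, a'}"] finite by (simp add: aff_dim_convex_hull)
    then have "negligible (convex hull (S - {a, a'}))"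
      by (simp add: negligible_convex_iff_aff_dim)
    then show ?thesis
      using convex_hull_delete_Int_subset [OF that(1,2)] negligible_subset by blast
  qed
  then have "(\<Sum>a\<in>positives. measure lebesgue (convex hull (S - {a})))
      = measure lebesgue (\<Union>a\<in>positives. convex hull (S - {a}))"
    using finite measurable by (intro measure_negligible_finite_Union_image [symmetric]) (auto simp: pairwise_def)
  also have "\<dots> \<le> measure lebesgue (convex hull S)"
    using finite measurable by (intro measure_mono_fmeasurable) (auto intro: hull_mono [THEN subsetD])
  finally show ?thesis .
qed

lemma pq_partition_positives_nonpositives:
  fixes S :: "(real^'n) set"
  assumes "unique_affine_dependence S c" "card S = CARD('n) + 2" "affine hull S = UNIV"
  defines "A \<equiv> {v\<in>S. 0 < c v}" and "B \<equiv> {v\<in>S. c v \<le> 0}"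
  shows "pq_partition S A B (card A - 1) (card B - 1)"
proof -
  interpret unique_affine_dependence S c
    by fact
  have parts: "finite positives" "finite nonpositives" "positives \<noteq> {}" "nonpositives \<noteq> {}"
    using finite exists_positive exists_negative by auto
  have cover: "positives \<union> nonpositives = S" "positives \<inter> nonpositives = {}"
    by auto
  then have "card positives + card nonpositives = CARD('n) + 2"
    using card_Un_disjoint [OF parts(1,2)] assms(2) by simp
  have direction: "direction_of X = {\<Sum>v\<in>X. u v *\<^sub>R v | u. sum u X = 0}" if "finite X" "X \<noteq> {}" for X
    unfolding direction_of_def using that by (rule span_differences_eq_zero_sum_combinations)
  have "y = 0" if y: "y \<in> direction_of positives" "y \<in> direction_of nonpositives" for y
  proof -
    obtain \<alpha> \<beta> where "sum \<alpha> positives = 0" "y = (\<Sum>v\<in>positives. \<alpha> v *\<^sub>R v)"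
      and "sum \<beta> nonpositives = 0" "y = (\<Sum>v\<in>nonpositives. \<beta> v *\<^sub>R v)"
      using y unfolding direction [OF parts(1,3)] direction [OF parts(2,4)] by blast
    then show "y = 0"
      using zero_sum_combinations_Int [of \<alpha> \<beta>] by simp
  qed
  moreover have "0 \<in> direction_of positives \<inter> direction_of nonpositives"
    by (simp add: direction_of_def span_zero)
  ultimately have "direction_of positives \<inter> direction_of nonpositives = {0}"
    by blast
  moreover have "{u + v | u v. u \<in> direction_of positives \<and> v \<in> direction_of nonpositives} = UNIV"
  proof (rule UNIV_eq_I [symmetric])
    fix z
    obtain e where "sum e positives = 0" "sum e nonpositives = 0"
      and "z = (\<Sum>v\<in>positives. e v *\<^sub>R v) + (\<Sum>v\<in>nonpositives. e v *\<^sub>R v)"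
      using assms(3) by (rule zero_sum_split_if_affine_hull_UNIV)
    then show "z \<in> {u + v | u v. u \<in> direction_of positives \<and> v \<in> direction_of nonpositives}"
      unfolding direction [OF parts(1,3)] direction [OF parts(2,4)] by blast
  qed
  moreover have "1 \<le> card positives" "1 \<le> card nonpositives"
    using parts by (simp_all add: Suc_le_eq card_gt_0_iff)
  ultimately show ?thesis
    unfolding pq_partition_def A_def B_def
    using parts cover \<open>card positives + card nonpositives = CARD('n) + 2\<close> convex_hull_positives_Int_nonpositives
      affine_independent_positives affine_independent_nonpositives
    by simp
qed

theorem lemma4p6:
  fixes S :: "(real^'n) set"
  assumes "finite S"
    and "card S = CARD('n) + 2"
    and "\<forall>x\<in>S. lattice_point x"
    and "aff_dim (convex hull S) = int CARD('n)"
  shows "measure lebesgue (convex hull S) \<ge> (real (p_min S) + 1) / fact CARD('n)"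
proof -
  have "aff_dim S = int (card S) - 2"
    using assms(2,4) by (simp add: aff_dim_convex_hull)
  then obtain c where dependence: "unique_affine_dependence S c"
    by (rule unique_affine_dependence_exists [OF assms(1)])
  then interpret unique_affine_dependence S c .
  have "affine hull S = UNIV"
    using assms(4) aff_dim_eq_full [of S] by (simp add: aff_dim_convex_hull)
  then have "pq_partition S positives nonpositives (card positives - 1) (card nonpositives - 1)"
    by (rule pq_partition_positives_nonpositives [OF dependence assms(2)])
  then have "p_min S \<le> card positives - 1"
    unfolding p_min_def by (blast intro: Least_le)
  moreover have "card positives \<ge> 1"
    using exists_positive finite by (auto simp: Suc_le_eq card_gt_0_iff)
  ultimately have "(real (p_min S) + 1) / fact CARD('n) \<le> (\<Sum>a\<in>positives. 1 / fact CARD('n))"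
    by (simp add: divide_right_mono)
  also have "\<dots> \<le> (\<Sum>a\<in>positives. measure lebesgue (convex hull (S - {a})))"
  proof (rule sum_mono)
    fix a assume "a \<in> positives"
    then show "1 / fact CARD('n) \<le> measure lebesgue (convex hull (S - {a}))"
      using assms(1-3) affine_independent_if_avoids [of "S - {a}" a]
      by (intro lattice_simplex_measure_ge) auto
  qed
  also have "\<dots> \<le> measure lebesgue (convex hull S)"
    using sum_measure_convex_hull_delete_le [OF dependence] assms(2) by simp
  finally show ?thesis .
qed

end
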